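(* Let $M=\mathbf X(U)\subset\mathbb R^{n+1}_1$ be a spacelike surface of codimension two. The following statements are equivalent: (1) there exist $r>0$ and a sign $*\in\{+,-\}$ such that $\mathbf n_r^*$ is parallel, not constant, and $M$ is $\mathbf n_r^*$-umbilic; (2) $M$ is contained in a right hypersphere in a hyperbolic space, i.e. there exist $\mathbf a\in\mathbb R^{n+1}_1$, $R>0$ and $c\in\mathbb R$ such that $M\subset H_+^n(\mathbf a,R)\cap\{x_{n+1}=c\}$.
   Context: $\mathbb R^{n+1}_1$ is $\mathbb R^{n+1}$ with the pseudo scalar product $\langle \mathbf x,\mathbf y\rangle=\sum_{i=1}^n x_iy_i-x_{n+1}y_{n+1}$. For $R>0$ and a point $\mathbf a$, the hyperbolic space with center $\mathbf a$ and radius $R$ is $H_+^n(\mathbf a,R)=\{\mathbf x:\langle\mathbf x-\mathbf a,\mathbf x-\mathbf a\rangle=-R^2,\ x_{n+1}-a_{n+1}\ge0\}$. A spacelike surface of codimension two is $M=\mathbf X(U)$, where $\mathbf X:U\to\mathbb R^{n+1}_1$ is a smooth embedding of an open domain $U\subset\mathbb R^{n-1}$ such that $\langle\cdot,\cdot\rangle$ is positive definite on every tangent space $T_pM$. The normal plane $N_pM$ (the pseudo-orthogonal complement of $T_pM$) is a timelike 2-plane, viewed as passing through the origin, and $\mathbb R^{n+1}_1=T_pM\oplus N_pM$. Let $\mathbf v=(0,\dots,0,-1)$. For $r>0$ and $p\in M$, the set $N_pM\cap H^n_+(\mathbf v,1)\cap\{x_{n+1}=r\}$ consists of exactly two points,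 denoted $\mathbf n_r^{\pm}(p)$; this gives two smooth normal vector fields $\mathbf n_r^{\pm}$ on $M$. For $*\in\{+,-\}$ the $\mathbf n_r^{*}$-Weingarten map at $p$ is $A_p^{\mathbf n_r^*}=-(d\mathbf n_r^{*}(p))^{T}:T_pM\to T_pM$, where $T$ denotes the $T_pM$-component; it is self-adjoint. $M$ is $\mathbf n_r^*$-umbilic if at every $p\in M$ all eigenvalues of $A_p^{\mathbf n_r^*}$ coincide. A smooth normal field $\nu$ on $M$ is parallel if the normal component of $d\nu$ vanishes, i.e. $d\nu(p)(T_pM)\subset T_pM$ for all $p\in M$.
   Formalization: The formal theorem assumes n ≥ 3 (dim M ≥ 2). For n = 2 the claim is false: an elliptic arc in {x_3 = 0} has n_r^± parallel and non-constant and is trivially umbilic, but lies on no circle. For n = 1, M is a point, so (2) holds and (1) fails. *)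

theory Defs
  imports "HOL-Analysis.Analysis"
begin

text \<open>Minkowski space of dimension n+1, with n = CARD('n), is split as space and time: the
  last coordinate of x is snd x.\<close>

type_synonym 'n mink = "(real ^ 'n) \<times> real"

definition mdot :: "'n::finite mink \<Rightarrow> 'n mink \<Rightarrow> real" where
  "mdot x y = (\<Sum>i\<in>UNIV. fst x $ i * fst y $ i) - snd x * snd y"

definition hyperbolic_space :: "'n::finite mink \<Rightarrow> real \<Rightarrow> 'n mink set" where
  "hyperbolic_space a R = {x. mdot (x - a) (x - a) = - (R\<^sup>2) \<and> snd x - snd a \<ge> 0}"

text \<open>Functions of class C^k, meant for open sets S only since derivatives are taken
  at full neighbourhoods.\<close>

fun Ck_on :: "nat \<Rightarrow> ('a::euclidean_space \<Rightarrow> 'b::euclidean_space) \<Rightarrow> 'a set \<Rightarrow> bool" where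
  "Ck_on 0 f S \<longleftrightarrow> continuous_on S f"
| "Ck_on (Suc k) f S \<longleftrightarrow> (\<forall>x\<in>S. f differentiable (at x)) \<and>
     (\<forall>v. Ck_on k (\<lambda>x. frechet_derivative f (at x) v) S)"

definition smooth_on :: "('a::euclidean_space \<Rightarrow> 'b::euclidean_space) \<Rightarrow> 'a set \<Rightarrow> bool" where
  "smooth_on f S \<longleftrightarrow> (\<forall>k. Ck_on k f S)"

definition smooth_embedding_on ::
  "('a::euclidean_space \<Rightarrow> 'b::euclidean_space) \<Rightarrow> 'a set \<Rightarrow> bool" where
  "smooth_embedding_on X U \<longleftrightarrow> smooth_on X U \<and>
     (\<forall>u\<in>U. inj (frechet_derivative X (at u))) \<and>
     (\<exists>Y. homeomorphism U (X ` U) X Y)"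

definition tangent_space :: "(real ^ 'm \<Rightarrow> 'n::finite mink) \<Rightarrow> real ^ 'm \<Rightarrow> 'n mink set" where
  "tangent_space X u = range (frechet_derivative X (at u))"

definition normal_space :: "(real ^ 'm \<Rightarrow> 'n::finite mink) \<Rightarrow> real ^ 'm \<Rightarrow> 'n mink set" where
  "normal_space X u = {w. \<forall>t\<in>tangent_space X u. mdot t w = 0}"

text \<open>The codimension of the image is two exactly when the two index types satisfy
  CARD('n) = CARD('m) + 1.\<close>

definition spacelike_codim2 :: "(real ^ 'm \<Rightarrow> 'n::finite mink) \<Rightarrow> (real ^ 'm) set \<Rightarrow> bool" where
  "spacelike_codim2 X U \<longleftrightarrow>
     CARD('n) = CARD('m) + 1 \<and>
     open U \<and> connected U \<and> U \<noteq> {} \<and>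
     smooth_embedding_on X U \<and>
     (\<forall>u\<in>U. \<forall>t\<in>tangent_space X u. t \<noteq> 0 \<longrightarrow> mdot t t > 0)"

text \<open>Vector fields on M = X(U) are represented by their pull-backs to U. A tangent vector t
  at X(u) is the image of a unique parameter vector, so the differential of a field at
  X(u), applied to t, is the derivative of the pull-back in that parameter direction.\<close>

definition field_diff ::
  "(real ^ 'm \<Rightarrow> 'n::finite mink) \<Rightarrow> (real ^ 'm \<Rightarrow> 'n mink) \<Rightarrow> real ^ 'm \<Rightarrow> 'n mink \<Rightarrow> 'n mink" where
  "field_diff X \<nu> u t =
     frechet_derivative \<nu> (at u) (THE \<xi>. frechet_derivative X (at u) \<xi> = t)"

definition tangential_part ::
  "(real ^ 'm \<Rightarrow> 'n::finite mink) \<Rightarrow> real ^ 'm \<Rightarrow> 'n mink \<Rightarrow> 'n mink" where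
  "tangential_part X u w = (THE t. t \<in> tangent_space X u \<and> w - t \<in> normal_space X u)"

definition weingarten ::
  "(real ^ 'm \<Rightarrow> 'n::finite mink) \<Rightarrow> (real ^ 'm \<Rightarrow> 'n mink) \<Rightarrow> real ^ 'm \<Rightarrow> 'n mink \<Rightarrow> 'n mink" where
  "weingarten X \<nu> u t = - tangential_part X u (field_diff X \<nu> u t)"

definition principal_curvature ::
  "(real ^ 'm \<Rightarrow> 'n::finite mink) \<Rightarrow> (real ^ 'm \<Rightarrow> 'n mink) \<Rightarrow> real ^ 'm \<Rightarrow> real \<Rightarrow> bool" where
  "principal_curvature X \<nu> u \<kappa> \<longleftrightarrow>
     (\<exists>t\<in>tangent_space X u. t \<noteq> 0 \<and> weingarten X \<nu> u t = \<kappa> *\<^sub>R t)"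

definition umbilic ::
  "(real ^ 'm \<Rightarrow> 'n::finite mink) \<Rightarrow> (real ^ 'm) set \<Rightarrow> (real ^ 'm \<Rightarrow> 'n mink) \<Rightarrow> bool" where
  "umbilic X U \<nu> \<longleftrightarrow>
     (\<forall>u\<in>U. \<forall>\<kappa> \<kappa>'. principal_curvature X \<nu> u \<kappa> \<and> principal_curvature X \<nu> u \<kappa>' \<longrightarrow> \<kappa> = \<kappa>')"

definition parallel_field ::
  "(real ^ 'm \<Rightarrow> 'n::finite mink) \<Rightarrow> (real ^ 'm) set \<Rightarrow> (real ^ 'm \<Rightarrow> 'n mink) \<Rightarrow> bool" where
  "parallel_field X U \<nu> \<longleftrightarrow>
     (\<forall>u\<in>U. field_diff X \<nu> u ` tangent_space X u \<subseteq> tangent_space X u)"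

text \<open>The two points of the normal plane on the unit hyperbolic space centred at (0,-1), at
  height r, form a two-sheeted covering of U; the two fields are its smooth sections. As U is
  connected, the unordered pair of fields is unique; which one carries the sign + is a
  matter of labelling.\<close>

definition n_fields ::
  "(real ^ 'm \<Rightarrow> 'n::finite mink) \<Rightarrow> (real ^ 'm) set \<Rightarrow> real \<Rightarrow>
   (real ^ 'm \<Rightarrow> 'n mink) \<Rightarrow> (real ^ 'm \<Rightarrow> 'n mink) \<Rightarrow> bool" where
  "n_fields X U r np nm \<longleftrightarrow>
     smooth_on np U \<and> smooth_on nm U \<and>
     (\<forall>u\<in>U. np u \<noteq> nm u \<and>
        normal_space X u \<inter> hyperbolic_space (0, -1) 1 \<inter> {x. snd x = r} = {np u, nm u})"

end

theory Submission
  imports Defs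
begin

text \<open>If the parallel field \<nu> is umbilic then, shape operators being self-adjoint, d\<nu> = \<kappa> dX for a
  function \<kappa>.  Differentiating once more and using the symmetry of the second derivatives of \<nu> and
  X gives d\<kappa>(\<eta>) \<xi> = d\<kappa>(\<xi>) \<eta>, so \<kappa> is a constant because M has dimension at least two,
  and it is nonzero because \<nu> is not constant.  Hence X is a translate of \<nu>/\<kappa>, and \<nu> lies on the
  slice at height r of a hyperbolic space, which is a round sphere.  Conversely, on a right
  hypersphere with centre a the normal plane is spanned by the spatial part p of X - a and the time
  axis, so the field with r = 1 is (s p, 1), where s is constant and s |p| = \<surd>3, and its differential
  is s dX.\<close>

subsection \<open>Symmetry of second derivatives\<close>

text \<open>The mean value theorem in direction \<open>\<xi>\<close> turns the second difference
  into \<open>t\<close> times an increment of \<open>f' _ \<xi>\<close>. Differentiability of that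
  map at the single point \<open>x\<close> then yields \<open>t\<^sup>2 * D \<eta>\<close> with
  error o(t^2).\<close>

lemma second_difference_approx:
  fixes f :: "'a::real_normed_vector \<Rightarrow> real"
  assumes "open S" "x \<in> S"
    and f': "\<And>y. y \<in> S \<Longrightarrow> (f has_derivative f' y) (at y)"
    and D: "((\<lambda>y. f' y \<xi>) has_derivative D) (at x)"
    and "e > 0"
  shows "\<exists>d>0. \<forall>t. 0 < t \<and> t < d \<longrightarrow>
    \<bar>f (x + t *\<^sub>R \<xi> + t *\<^sub>R \<eta>) - f (x + t *\<^sub>R \<xi>) - f (x + t *\<^sub>R \<eta>) + f x - t\<^sup>2 * D \<eta>\<bar> \<le> e * t\<^sup>2"
proof -
  \<comment> \<open>Points \<open>x + s *\<^sub>R \<xi> + r *\<^sub>R \<eta>\<close> with both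
    coefficients in [0,t] stay within \<open>t * K\<close> of \<open>x\<close>; the summand 1 keeps
    \<open>K\<close> positive when both vectors vanish.\<close>
  define K where "K = norm \<xi> + norm \<eta> + 1"
  have K: "K > 0" by (simp add: K_def add_nonneg_pos)
  obtain d0 where d0: "d0 > 0" "ball x d0 \<subseteq> S"
    using assms(1,2) open_contains_ball by blast
  \<comment> \<open>The linear approximation is used at two points at distance at most
    \<open>t * K\<close>, and each use costs at most \<open>e / 2 * t\<close>.\<close>
  have "e / (2 * K) > 0" using K \<open>e > 0\<close> by simp
  then obtain d1 where d1: "d1 > 0"
    "\<And>y. norm (y - x) < d1 \<Longrightarrow> norm (f' y \<xi> - f' x \<xi> - D (y - x)) \<le> e / (2 * K) * norm (y - x)"
    using D unfolding has_derivative_at_alt by metis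
  have linD: "linear D" using D has_derivative_linear by blast
  define d where "d = min d0 d1 / K"
  have "d > 0" using d0 d1 K by (simp add: d_def)
  moreover have "\<bar>f (x + t *\<^sub>R \<xi> + t *\<^sub>R \<eta>) - f (x + t *\<^sub>R \<xi>) - f (x + t *\<^sub>R \<eta>) + f x - t\<^sup>2 * D \<eta>\<bar> \<le> e * t\<^sup>2"
    if t: "0 < t" "t < d" for t
  proof -
    have tK: "t * K < d0" "t * K < d1"
      using t K by (auto simp: d_def field_simps)
    have nrm: "norm (s *\<^sub>R \<xi> + r *\<^sub>R \<eta>) \<le> t * K" if "0 \<le> s" "s \<le> t" "0 \<le> r" "r \<le> t" for s r
    proof -
      have "norm (s *\<^sub>R \<xi> + r *\<^sub>R \<eta>) \<le> s * norm \<xi> + r * norm \<eta>"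
        using norm_triangle_ineq[of "s *\<^sub>R \<xi>" "r *\<^sub>R \<eta>"] that by simp
      also have "\<dots> \<le> t * norm \<xi> + t * norm \<eta>"
        using that by (intro add_mono mult_right_mono) auto
      also have "\<dots> \<le> t * K" using t by (simp add: K_def algebra_simps)
      finally show ?thesis .
    qed
    have inS: "x + s *\<^sub>R \<xi> + r *\<^sub>R \<eta> \<in> S" if "0 \<le> s" "s \<le> t" "0 \<le> r" "r \<le> t" for s r
    proof -
      have "dist (x + (s *\<^sub>R \<xi> + r *\<^sub>R \<eta>)) x < d0"
        using nrm[OF that] tK(1) by (simp add: dist_norm)
      then show ?thesis using d0(2) by (auto simp: add.assoc dist_commute)
    qed
    \<comment> \<open>The second difference is \<open>\<phi> t - \<phi> 0\<close>.\<close>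
    define \<phi> where "\<phi> s = f (x + s *\<^sub>R \<xi> + t *\<^sub>R \<eta>) - f (x + s *\<^sub>R \<xi>)" for s
    define \<phi>' where "\<phi>' s h = f' (x + s *\<^sub>R \<xi> + t *\<^sub>R \<eta>) (h *\<^sub>R \<xi>) - f' (x + s *\<^sub>R \<xi>) (h *\<^sub>R \<xi>)" for s h :: real
    have der: "(\<phi> has_derivative \<phi>' s) (at s within {0..t})" if s: "0 \<le> s" "s \<le> t" for s
    proof -
      have a: "(f has_derivative f' (x + s *\<^sub>R \<xi> + t *\<^sub>R \<eta>)) (at (x + s *\<^sub>R \<xi> + t *\<^sub>R \<eta>))"
        using inS[of s t] f' s t by auto
      have b: "(f has_derivative f' (x + s *\<^sub>R \<xi>)) (at (x + s *\<^sub>R \<xi>))"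
        using inS[of s 0] f' s t by auto
      have c: "((\<lambda>s. x + s *\<^sub>R \<xi> + t *\<^sub>R \<eta>) has_derivative (\<lambda>h. h *\<^sub>R \<xi>)) (at s within {0..t})"
        by (auto intro!: derivative_eq_intros)
      have d: "((\<lambda>s. x + s *\<^sub>R \<xi>) has_derivative (\<lambda>h. h *\<^sub>R \<xi>)) (at s within {0..t})"
        by (auto intro!: derivative_eq_intros)
      show ?thesis unfolding \<phi>_def \<phi>'_def
        by (intro has_derivative_diff has_derivative_compose[OF c a] has_derivative_compose[OF d b])
    qed
    obtain s where s: "0 < s" "s < t" "\<phi> t - \<phi> 0 = \<phi>' s (t - 0)"
      using mvt_simple[of 0 t \<phi> \<phi>'] der t by auto
    have l: "f' y (t *\<^sub>R \<xi>) = t * f' y \<xi>" if "y \<in> S" for y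
      using f'[OF that] has_derivative_linear linear_cmul by fastforce
    define P where "P = f' (x + s *\<^sub>R \<xi> + t *\<^sub>R \<eta>) \<xi>"
    define Q where "Q = f' (x + s *\<^sub>R \<xi>) \<xi>"
    have eq: "\<phi> t - \<phi> 0 = t * (P - Q)"
      using s inS[of s t] inS[of s 0] t by (simp add: \<phi>'_def l P_def Q_def right_diff_distrib)
    have near: "\<bar>f' (x + z) \<xi> - f' x \<xi> - D z\<bar> \<le> e / 2 * t" if "norm z \<le> t * K" for z
    proof -
      have "\<bar>f' (x + z) \<xi> - f' x \<xi> - D z\<bar> \<le> e / (2 * K) * norm z"
        using d1(2)[of "x + z"] tK(2) that by simp
      also have "\<dots> \<le> e / (2 * K) * (t * K)"
        using that K \<open>e > 0\<close> by (intro mult_left_mono) auto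
      also have "\<dots> = e / 2 * t" using K by simp
      finally show ?thesis .
    qed
    have "\<bar>P - f' x \<xi> - D (s *\<^sub>R \<xi> + t *\<^sub>R \<eta>)\<bar> \<le> e / 2 * t"
      using near[of "s *\<^sub>R \<xi> + t *\<^sub>R \<eta>"] nrm[of s t] s t by (simp add: P_def add.assoc)
    moreover have "\<bar>Q - f' x \<xi> - D (s *\<^sub>R \<xi>)\<bar> \<le> e / 2 * t"
      using near[of "s *\<^sub>R \<xi>"] nrm[of s 0] s t by (simp add: Q_def)
    moreover have "D (s *\<^sub>R \<xi> + t *\<^sub>R \<eta>) = D (s *\<^sub>R \<xi>) + t * D \<eta>"
      using linD by (simp add: linear_add linear_cmul)
    ultimately have "\<bar>P - Q - t * D \<eta>\<bar> \<le> e * t" by linarith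
    then have "t * \<bar>P - Q - t * D \<eta>\<bar> \<le> t * (e * t)" using t by (intro mult_left_mono) auto
    moreover have "t * \<bar>P - Q - t * D \<eta>\<bar> = \<bar>t * (P - Q) - t\<^sup>2 * D \<eta>\<bar>"
    proof -
      have "t * \<bar>P - Q - t * D \<eta>\<bar> = \<bar>t * (P - Q - t * D \<eta>)\<bar>" using t by (simp add: abs_mult)
      then show ?thesis by (simp add: algebra_simps power2_eq_square)
    qed
    ultimately show ?thesis using eq by (simp add: \<phi>_def algebra_simps power2_eq_square)
  qed
  ultimately show ?thesis by blast
qed

text \<open>The second difference is unchanged when \<open>\<xi>\<close> and \<open>\<eta>\<close>
  are swapped, so \<open>t\<^sup>2 * D \<eta>\<close> and \<open>t\<^sup>2 * E \<xi>\<close> differ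
  by o(t^2). Coordinates are taken because the mean value estimate is for real functions.\<close>

lemma symmetric_second_derivative:
  fixes f :: "'a::real_normed_vector \<Rightarrow> 'b::euclidean_space"
  assumes S: "open S" "x \<in> S"
    and f': "\<And>y. y \<in> S \<Longrightarrow> (f has_derivative f' y) (at y)"
    and D: "((\<lambda>y. f' y \<xi>) has_derivative D) (at x)"
    and E: "((\<lambda>y. f' y \<eta>) has_derivative E) (at x)"
  shows "D \<eta> = E \<xi>"
proof (rule euclidean_eqI)
  fix b :: 'b assume "b \<in> Basis"
  have f'b: "((\<lambda>y. f y \<bullet> b) has_derivative (\<lambda>h. f' y h \<bullet> b)) (at y)" if "y \<in> S" for y
    using f'[OF that] by (rule has_derivative_inner_left)
  have Db: "((\<lambda>y. f' y \<xi> \<bullet> b) has_derivative (\<lambda>h. D h \<bullet> b)) (at x)"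
    using D by (rule has_derivative_inner_left)
  have Eb: "((\<lambda>y. f' y \<eta> \<bullet> b) has_derivative (\<lambda>h. E h \<bullet> b)) (at x)"
    using E by (rule has_derivative_inner_left)
  have "\<bar>D \<eta> \<bullet> b - E \<xi> \<bullet> b\<bar> \<le> e" if "e > 0" for e
  proof -
    have e: "e / 2 > 0" using that by simp
    obtain d1 where d1: "d1 > 0" "\<And>t. 0 < t \<Longrightarrow> t < d1 \<Longrightarrow>
      \<bar>f (x + t *\<^sub>R \<xi> + t *\<^sub>R \<eta>) \<bullet> b - f (x + t *\<^sub>R \<xi>) \<bullet> b - f (x + t *\<^sub>R \<eta>) \<bullet> b + f x \<bullet> b
        - t\<^sup>2 * (D \<eta> \<bullet> b)\<bar> \<le> e / 2 * t\<^sup>2"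
      using second_difference_approx[OF S f'b Db e, of \<eta>] by auto
    obtain d2 where d2: "d2 > 0" "\<And>t. 0 < t \<Longrightarrow> t < d2 \<Longrightarrow>
      \<bar>f (x + t *\<^sub>R \<eta> + t *\<^sub>R \<xi>) \<bullet> b - f (x + t *\<^sub>R \<eta>) \<bullet> b - f (x + t *\<^sub>R \<xi>) \<bullet> b + f x \<bullet> b
        - t\<^sup>2 * (E \<xi> \<bullet> b)\<bar> \<le> e / 2 * t\<^sup>2"
      using second_difference_approx[OF S f'b Eb e, of \<xi>] by auto
    define t where "t = min d1 d2 / 2"
    have t: "0 < t" "t < d1" "t < d2" using d1(1) d2(1) by (auto simp: t_def)
    have c: "x + t *\<^sub>R \<eta> + t *\<^sub>R \<xi> = x + t *\<^sub>R \<xi> + t *\<^sub>R \<eta>" by (simp add: algebra_simps)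
    have "\<bar>t\<^sup>2 * (D \<eta> \<bullet> b) - t\<^sup>2 * (E \<xi> \<bullet> b)\<bar> \<le> e * t\<^sup>2"
      using d1(2)[OF t(1,2)] d2(2)[OF t(1,3)] unfolding c by linarith
    also have "t\<^sup>2 * (D \<eta> \<bullet> b) - t\<^sup>2 * (E \<xi> \<bullet> b) = t\<^sup>2 * (D \<eta> \<bullet> b - E \<xi> \<bullet> b)"
      by (simp add: algebra_simps)
    finally have "t\<^sup>2 * \<bar>D \<eta> \<bullet> b - E \<xi> \<bullet> b\<bar> \<le> t\<^sup>2 * e"
      by (simp add: abs_mult mult.commute)
    then show ?thesis using t by (simp add: mult_le_cancel_left)
  qed
  then show "D \<eta> \<bullet> b = E \<xi> \<bullet> b"
    by (metis abs_le_zero_iff field_le_epsilon add_0 right_minus_eq)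
qed

subsection \<open>Symmetric bilinear forms\<close>

text \<open>The first variation of a Rayleigh quotient vanishes at its minimum. Here
  \<open>k\<close> is the least eigenvalue of \<open>b\<close> relative to \<open>g\<close> and
  \<open>x\<close> an eigenvector, expressed through the forms instead of an operator.\<close>

lemma symmetric_form_min_eigenvector:
  fixes b g :: "'a::euclidean_space \<Rightarrow> 'a \<Rightarrow> real"
  assumes b: "bounded_bilinear b" "\<And>x y. b x y = b y x"
    and g: "bounded_bilinear g" "\<And>x y. g x y = g y x" "\<And>x. x \<noteq> 0 \<Longrightarrow> g x x > 0"
  obtains k x where "x \<noteq> 0" "\<And>y. b x y = k * g x y" "\<And>z. k * g z z \<le> b z z"
proof -
  interpret B: bounded_bilinear b by fact
  interpret G: bounded_bilinear g by fact
  \<comment> \<open>The eigenvector minimises the Rayleigh quotient b x x / g x x.\<close>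
  have "g x x \<noteq> 0" if "x \<in> sphere 0 1" for x
    using g(3)[of x] that by fastforce
  then have "continuous_on (sphere 0 1) (\<lambda>x. b x x / g x x)"
    by (intro continuous_intros B.continuous_on G.continuous_on) auto
  moreover have "sphere (0::'a) 1 \<noteq> {}" by simp
  ultimately obtain x where x: "x \<in> sphere 0 1"
    and min: "\<And>y. y \<in> sphere 0 1 \<Longrightarrow> b x x / g x x \<le> b y y / g y y"
    using continuous_attains_inf[of "sphere (0::'a) 1" "\<lambda>x. b x x / g x x"] by auto
  define k where "k = b x x / g x x"
  have x0: "x \<noteq> 0" using x by auto
  have le: "k * g z z \<le> b z z" for z
  proof (cases "z = 0")
    case True then show ?thesis by (simp add: B.zero_left G.zero_left)
  next
    case False
    have "k \<le> b (z /\<^sub>R norm z) (z /\<^sub>R norm z) / g (z /\<^sub>R norm z) (z /\<^sub>R norm z)"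
      unfolding k_def using False by (intro min) simp
    also have "\<dots> = b z z / g z z"
      using False by (simp add: B.scaleR_left B.scaleR_right G.scaleR_left G.scaleR_right)
    finally show ?thesis using g(3)[OF False] by (simp add: field_simps)
  qed
  have q0: "b x x - k * g x x = 0" using g(3)[OF x0] by (simp add: k_def)
  have "b x y = k * g x y" for y
  proof -
    define p where "p = b x y - k * g x y"
    define q where "q = b y y - k * g y y"
    \<comment> \<open>The form \<open>b - k * g\<close> is positive semidefinite and vanishes at
      \<open>x\<close>. On the line through \<open>x\<close> in direction \<open>y\<close> it is
      this polynomial in \<open>s\<close>, so its linear coefficient has to vanish.\<close>
    have ineq: "0 \<le> 2 * s * p + s\<^sup>2 * q" for s
    proof -
      have "b (x + s *\<^sub>R y) (x + s *\<^sub>R y) - k * g (x + s *\<^sub>R y) (x + s *\<^sub>R y)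
        = (b x x - k * g x x) + 2 * s * p + s\<^sup>2 * q"
        unfolding p_def q_def
        by (simp add: B.add_left B.add_right G.add_left G.add_right B.scaleR_left B.scaleR_right
            G.scaleR_left G.scaleR_right b(2)[of y x] g(2)[of y x] algebra_simps power2_eq_square)
      then show ?thesis using le[of "x + s *\<^sub>R y"] q0 by simp
    qed
    have "q \<ge> 0" using le[of y] by (simp add: q_def)
    have "p = 0"
    proof (rule ccontr)
      assume "p \<noteq> 0"
      \<comment> \<open>At \<open>s = - t\<close> the polynomial becomes negative; dividing by
        \<open>q + 1\<close> covers the case \<open>q = 0\<close> as well.\<close>
      define t where "t = p / (q + 1)"
      have p: "p = t * (q + 1)" "t \<noteq> 0" using \<open>q \<ge> 0\<close> \<open>p \<noteq> 0\<close> by (auto simp: t_def)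
      have "2 * (- t) * p + (- t)\<^sup>2 * q = - (t\<^sup>2 * (q + 2))"
        by (simp add: p(1) power2_eq_square algebra_simps)
      moreover have "t\<^sup>2 * (q + 2) > 0" using p(2) \<open>q \<ge> 0\<close> by simp
      ultimately show False using ineq[of "- t"] by simp
    qed
    then show ?thesis by (simp add: p_def)
  qed
  then show thesis using that x0 le by blast
qed

text \<open>If the least and the greatest relative eigenvalue coincide, \<open>b\<close> and
  \<open>k * g\<close> agree on the diagonal, and polarisation makes them equal.\<close>

lemma symmetric_form_single_eigenvalue:
  fixes b g :: "'a::euclidean_space \<Rightarrow> 'a \<Rightarrow> real"
  assumes b: "bounded_bilinear b" "\<And>x y. b x y = b y x"
    and g: "bounded_bilinear g" "\<And>x y. g x y = g y x" "\<And>x. x \<noteq> 0 \<Longrightarrow> g x x > 0"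
    and single: "\<And>k l x z. x \<noteq> 0 \<Longrightarrow> z \<noteq> 0 \<Longrightarrow> (\<And>y. b x y = k * g x y) \<Longrightarrow>
      (\<And>y. b z y = l * g z y) \<Longrightarrow> k = l"
  shows "\<exists>k. \<forall>x y. b x y = k * g x y"
proof -
  obtain k x where x: "x \<noteq> 0" "\<And>y. b x y = k * g x y" "\<And>z. k * g z z \<le> b z z"
    using symmetric_form_min_eigenvector[OF b g] by metis
  \<comment> \<open>The least eigenvalue of the negated form is minus the greatest eigenvalue.\<close>
  have nb: "bounded_bilinear (\<lambda>x y. - b x y)" 
    using b(1) by (simp add: bilinear_conv_bounded_bilinear[symmetric] bilinear_def linear_compose_neg)
  obtain l z where z: "z \<noteq> 0" "\<And>y. - b z y = l * g z y" "\<And>z. l * g z z \<le> - b z z"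
    using symmetric_form_min_eigenvector[OF nb _ g] b(2) by metis
  have "k = - l" using single[OF x(1) z(1), of k "- l"] x(2) z(2) by (metis minus_equation_iff mult_minus_left)
  then have diag: "b y y = k * g y y" for y using x(3)[of y] z(3)[of y] by (simp add: algebra_simps)
  interpret B: bounded_bilinear b by fact
  interpret G: bounded_bilinear g by fact
  have "b x y = k * g x y" for x y
    using diag[of "x + y"] diag[of x] diag[of y] b(2)[of y x] g(2)[of y x]
    by (simp add: B.add_left B.add_right G.add_left G.add_right algebra_simps)
  then show ?thesis by blast
qed

subsection \<open>Smooth maps into Minkowski space\<close>

lemma mdot_eq_inner: "mdot x y = fst x \<bullet> fst y - snd x * snd y"
  by (simp add: mdot_def inner_vec_def)

lemma bounded_bilinear_mdot: "bounded_bilinear (mdot :: 'n::finite mink \<Rightarrow> 'n mink \<Rightarrow> real)"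
  unfolding bilinear_conv_bounded_bilinear[symmetric] bilinear_def
  by (auto intro!: linearI simp: mdot_eq_inner inner_simps algebra_simps)

interpretation mdot: bounded_bilinear "mdot :: 'n::finite mink \<Rightarrow> 'n mink \<Rightarrow> real"
  by (rule bounded_bilinear_mdot)

lemma mdot_commute: "mdot x y = mdot y x"
  by (simp add: mdot_eq_inner inner_commute)

text \<open>\<open>Ck_on\<close> takes derivatives at full neighbourhoods; openness of
  \<open>S\<close> lets the values on \<open>S\<close> determine them.\<close>

lemma Ck_on_cong:
  assumes "open S" "\<And>x. x \<in> S \<Longrightarrow> f x = g x" "Ck_on k f S"
  shows "Ck_on k g S"
  using assms
proof (induction k arbitrary: f g)
  case 0
  then show ?case by (metis Ck_on.simps(1) continuous_on_cong)
next
  case (Suc k)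
  have fd: "f differentiable (at x)" if "x \<in> S" for x using Suc.prems that by simp
  have gd: "g differentiable (at x)" if "x \<in> S" for x
    using fd[OF that] Suc.prems(1,2) that
    by (meson differentiable_def has_derivative_transform_within_open)
  have eq: "frechet_derivative f (at x) v = frechet_derivative g (at x) v" if "x \<in> S" for x v
    using frechet_derivative_transform_within_open[OF fd[OF that] Suc.prems(1) that Suc.prems(2)] by simp
  have "Ck_on k (\<lambda>x. frechet_derivative g (at x) v) S" for v
    using Suc.IH[OF Suc.prems(1), of "\<lambda>x. frechet_derivative f (at x) v"] eq Suc.prems(3) by auto
  then show ?case using gd by simp
qed

text \<open>Supplies the smoothness of normal fields that depend affinely on \<open>X\<close>. The
  constant \<open>c\<close> is generalised in the induction because differentiation replaces it by
  0.\<close>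

lemma Ck_on_affine:
  fixes f :: "'a::euclidean_space \<Rightarrow> 'b::euclidean_space" and L :: "'b \<Rightarrow> 'c::euclidean_space"
  assumes "bounded_linear L" "open S" "Ck_on k f S"
  shows "Ck_on k (\<lambda>x. L (f x) + c) S"
  using assms(3)
proof (induction k arbitrary: f c)
  case 0
  then show ?case
    by (intro continuous_on_add[OF bounded_linear.continuous_on[OF assms(1)] continuous_on_const,
          THEN Ck_on.simps(1)[THEN iffD2]]) simp
next
  case (Suc k)
  have der: "((\<lambda>x. L (f x) + c) has_derivative (\<lambda>h. L (frechet_derivative f (at x) h))) (at x)"
    if "x \<in> S" for x
  proof -
    have "(f has_derivative frechet_derivative f (at x)) (at x)"
      using Suc.prems that frechet_derivative_works by auto
    then show ?thesis
      by (auto intro!: derivative_eq_intros bounded_linear.has_derivative[OF assms(1)])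
  qed
  \<comment> \<open>The summand 0 puts the derivative into the affine form of the induction
    hypothesis.\<close>
  have eq: "frechet_derivative (\<lambda>x. L (f x) + c) (at x) v = L (frechet_derivative f (at x) v) + 0"
    if "x \<in> S" for x v
    using frechet_derivative_at[OF der[OF that]] by (metis add.right_neutral)
  have "Ck_on k (\<lambda>x. frechet_derivative (\<lambda>x. L (f x) + c) (at x) v) S" for v
    by (rule Ck_on_cong[OF assms(2) eq[symmetric]], assumption, rule Suc.IH) (use Suc.prems in simp)
  then show ?case using der by (auto simp: differentiable_def)
qed

lemma smooth_on_affine:
  assumes "bounded_linear L" "open S" "smooth_on f S"
  shows "smooth_on (\<lambda>x. L (f x) + c) S"
  using assms Ck_on_affine unfolding smooth_on_def by blast

lemma smooth_on_frechet_derivative: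
  assumes "smooth_on f S"
  shows "smooth_on (\<lambda>x. frechet_derivative f (at x) v) S"
  using assms unfolding smooth_on_def by (metis Ck_on.simps(2))

lemma smooth_on_has_derivative:
  assumes "smooth_on f S" "x \<in> S"
  shows "(f has_derivative frechet_derivative f (at x)) (at x)"
  using assms unfolding smooth_on_def by (metis Ck_on.simps(2) frechet_derivative_works)

lemma smooth_on_second_derivative_symmetric:
  assumes "smooth_on f S" "open S" "x \<in> S"
  shows "frechet_derivative (\<lambda>y. frechet_derivative f (at y) \<xi>) (at x) \<eta> =
         frechet_derivative (\<lambda>y. frechet_derivative f (at y) \<eta>) (at x) \<xi>"
  using symmetric_second_derivative[OF assms(2,3) smooth_on_has_derivative[OF assms(1)]]
    smooth_on_has_derivative[OF smooth_on_frechet_derivative[OF assms(1)] assms(3)]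
  by blast

subsection \<open>Spacelike surfaces of codimension two\<close>

context
  fixes X :: "real ^ 'm \<Rightarrow> 'n::finite mink" and U :: "(real ^ 'm) set"
  assumes surface: "spacelike_codim2 X U"
begin

lemma surface_basic:
  shows open_domain: "open U" and connected_domain: "connected U" and nonempty_domain: "U \<noteq> {}"
    and smooth_surface: "smooth_on X U" and codim: "CARD('n) = CARD('m) + 1"
  using surface by (auto simp: spacelike_codim2_def smooth_embedding_on_def)

lemma inj_derivative: "u \<in> U \<Longrightarrow> inj (frechet_derivative X (at u))"
  using surface by (auto simp: spacelike_codim2_def smooth_embedding_on_def)

lemma has_derivative_surface: "u \<in> U \<Longrightarrow> (X has_derivative frechet_derivative X (at u)) (at u)"
  using smooth_on_has_derivative smooth_surface by blast

lemma linear_derivative: "u \<in> U \<Longrightarrow> linear (frechet_derivative X (at u))"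
  using has_derivative_surface has_derivative_linear by blast

lemma derivative_eq_0_iff: "u \<in> U \<Longrightarrow> frechet_derivative X (at u) \<xi> = 0 \<longleftrightarrow> \<xi> = 0"
  using inj_derivative linear_derivative linear_injective_0 linear_0 by metis

lemma mdot_tangent_pos: "u \<in> U \<Longrightarrow> t \<in> tangent_space X u \<Longrightarrow> t \<noteq> 0 \<Longrightarrow> mdot t t > 0"
  using surface by (auto simp: spacelike_codim2_def)

text \<open>Such a \<open>t\<close> is orthogonal to itself, and \<open>mdot\<close> is positive
  definite on the tangent space.\<close>

lemma tangent_eq_0:
  assumes "u \<in> U" "t \<in> tangent_space X u" "\<And>\<eta>. mdot t (frechet_derivative X (at u) \<eta>) = 0"
  shows "t = 0"
  using assms mdot_tangent_pos[of u t] by (force simp: tangent_space_def)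

lemma subspace_tangent_space: "u \<in> U \<Longrightarrow> subspace (tangent_space X u)"
  unfolding tangent_space_def using linear_subspace_image[OF linear_derivative subspace_UNIV] .

text \<open>Injectivity of the differential of \<open>X\<close> makes \<open>\<xi>\<close> the only
  vector that the definite description can select.\<close>

lemma field_diff_tangent:
  "u \<in> U \<Longrightarrow> field_diff X \<nu> u (frechet_derivative X (at u) \<xi>) = frechet_derivative \<nu> (at u) \<xi>"
  unfolding field_diff_def using inj_derivative[of u] by (simp add: inj_eq)

text \<open>Two candidates differ by a vector that is both tangent and normal, hence zero by
  positive definiteness. The derivatives of a parallel field are tangent, so this evaluates its
  Weingarten map.\<close>

lemma tangential_part_tangent:
  assumes "u \<in> U" "t \<in> tangent_space X u"
  shows "tangential_part X u t = t"
  unfolding tangential_part_def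
proof (rule the_equality)
  show "t \<in> tangent_space X u \<and> t - t \<in> normal_space X u"
    using assms by (simp add: normal_space_def mdot.zero_right)
next
  fix t' assume t': "t' \<in> tangent_space X u \<and> t - t' \<in> normal_space X u"
  then have "t - t' \<in> tangent_space X u"
    using assms subspace_tangent_space subspace_diff by blast
  moreover have "mdot (t - t') (t - t') = 0"
    using calculation t' by (auto simp: normal_space_def)
  ultimately show "t' = t" using mdot_tangent_pos[OF assms(1), of "t - t'"] by force
qed

section \<open>From an umbilic parallel field to a right hypersphere\<close>

text \<open>Umbilicity leaves the second fundamental form in direction \<open>\<nu>\<close> a single
  eigenvalue relative to the first, so the two forms are proportional. As the derivative of a
  parallel field is tangent, proportional forms give proportional vectors.\<close>

lemma umbilic_parallel_field_scalar:
  assumes \<nu>: "smooth_on \<nu> U" "\<And>u. u \<in> U \<Longrightarrow> \<nu> u \<in> normal_space X u"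
    and "parallel_field X U \<nu>" "umbilic X U \<nu>" and u: "u \<in> U"
  obtains k where "\<And>\<xi>. frechet_derivative \<nu> (at u) \<xi> = k *\<^sub>R frechet_derivative X (at u) \<xi>"
proof -
  define D where "D = frechet_derivative X (at u)"
  define N where "N = frechet_derivative \<nu> (at u)"
  define H where "H \<xi> = frechet_derivative (\<lambda>y. frechet_derivative X (at y) \<xi>) (at u)" for \<xi>
  have linD: "linear D" using linear_derivative[OF u] by (simp add: D_def)
  have \<nu>': "(\<nu> has_derivative N) (at u)"
    using smooth_on_has_derivative[OF \<nu>(1) u] by (simp add: N_def)
  then have linN: "linear N" by (rule has_derivative_linear)
  have H: "((\<lambda>y. frechet_derivative X (at y) \<xi>) has_derivative H \<xi>) (at u)" for \<xi>
    unfolding H_def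
    using smooth_on_has_derivative smooth_on_frechet_derivative smooth_surface u by blast
  have N_tangent: "N \<xi> \<in> tangent_space X u" for \<xi>
  proof -
    have "field_diff X \<nu> u (D \<xi>) \<in> tangent_space X u"
      using assms(3) u unfolding parallel_field_def tangent_space_def D_def by blast
    then show ?thesis using field_diff_tangent[OF u] by (simp add: D_def N_def)
  qed
  \<comment> \<open>Differentiate the relation that \<open>\<nu>\<close> is orthogonal to
    \<open>frechet_derivative X (at y) \<eta>\<close>, in direction \<open>\<xi>\<close>. Symmetry
    of the Hessian of \<open>X\<close> then makes the Weingarten map self-adjoint.\<close>
  have b_hess: "mdot (N \<xi>) (D \<eta>) = - mdot (\<nu> u) (H \<eta> \<xi>)" for \<xi> \<eta>
  proof -
    have "((\<lambda>y. mdot (\<nu> y) (frechet_derivative X (at y) \<eta>)) has_derivative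
        (\<lambda>h. mdot (\<nu> u) (H \<eta> h) + mdot (N h) (D \<eta>))) (at u)"
      using mdot.FDERIV[OF \<nu>' H[of \<eta>]] by (simp add: D_def)
    moreover have "((\<lambda>y. mdot (\<nu> y) (frechet_derivative X (at y) \<eta>)) has_derivative (\<lambda>h. 0)) (at u)"
    proof (rule has_derivative_transform_within_open[OF has_derivative_const[of 0] open_domain u])
      fix y assume "y \<in> U"
      then show "0 = mdot (\<nu> y) (frechet_derivative X (at y) \<eta>)"
        using \<nu>(2)[of y]
        by (auto simp: normal_space_def tangent_space_def mdot_commute[of "\<nu> y"])
    qed
    ultimately have "(\<lambda>h. mdot (\<nu> u) (H \<eta> h) + mdot (N h) (D \<eta>)) = (\<lambda>h. 0)"
      by (rule has_derivative_unique)
    from fun_cong[OF this, of \<xi>] show ?thesis by simp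
  qed
  have b_sym: "mdot (N \<xi>) (D \<eta>) = mdot (N \<eta>) (D \<xi>)" for \<xi> \<eta>
    using b_hess smooth_on_second_derivative_symmetric[OF smooth_surface open_domain u]
    by (simp add: H_def)
  \<comment> \<open>Pulled back to the parameter space, these are minus the second fundamental form
    and the first fundamental form.\<close>
  have bb: "bounded_bilinear (\<lambda>\<xi> \<eta>. mdot (N \<xi>) (D \<eta>))"
    and bg: "bounded_bilinear (\<lambda>\<xi> \<eta>. mdot (D \<xi>) (D \<eta>))"
    using mdot.comp linD linN by (simp_all add: linear_conv_bounded_linear)
  have g_pos: "mdot (D \<xi>) (D \<xi>) > 0" if "\<xi> \<noteq> 0" for \<xi>
    using mdot_tangent_pos[OF u, of "D \<xi>"] derivative_eq_0_iff[OF u, of \<xi>] that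
    by (auto simp: D_def tangent_space_def)
  have tangent0: "N \<xi> = k *\<^sub>R D \<xi>" if "\<And>\<eta>. mdot (N \<xi>) (D \<eta>) = k * mdot (D \<xi>) (D \<eta>)" for k \<xi>
  proof -
    have "D \<xi> \<in> tangent_space X u" by (simp add: D_def tangent_space_def)
    then have "N \<xi> - k *\<^sub>R D \<xi> \<in> tangent_space X u"
      using N_tangent subspace_tangent_space[OF u] subspace_diff subspace_scale by blast
    moreover have "mdot (N \<xi> - k *\<^sub>R D \<xi>) (D \<eta>) = 0" for \<eta>
      using that by (simp add: mdot.diff_left mdot.scaleR_left)
    ultimately have "N \<xi> - k *\<^sub>R D \<xi> = 0"
      using tangent_eq_0[OF u] unfolding D_def by blast
    then show ?thesis by simp
  qed
  \<comment> \<open>The sign comes from the minus in the Weingarten map.\<close>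
  have pc: "principal_curvature X \<nu> u (- k)"
    if "\<xi> \<noteq> 0" "\<And>\<eta>. mdot (N \<xi>) (D \<eta>) = k * mdot (D \<xi>) (D \<eta>)" for k \<xi>
    unfolding principal_curvature_def weingarten_def
  proof (rule bexI[of _ "D \<xi>"])
    show "D \<xi> \<in> tangent_space X u" by (simp add: D_def tangent_space_def)
    show "D \<xi> \<noteq> 0 \<and> - tangential_part X u (field_diff X \<nu> u (D \<xi>)) = - k *\<^sub>R D \<xi>"
      using derivative_eq_0_iff[OF u] that(1) tangent0[OF that(2)]
        tangential_part_tangent[OF u N_tangent[of \<xi>]] field_diff_tangent[OF u, of \<nu> \<xi>]
      by (simp add: D_def N_def)
  qed
  have single: "k = l" if "x \<noteq> 0" "z \<noteq> 0" "\<And>y. mdot (N x) (D y) = k * mdot (D x) (D y)"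
    "\<And>y. mdot (N z) (D y) = l * mdot (D z) (D y)" for k l x z
    using pc[OF that(1,3)] pc[OF that(2,4)] assms(4) u unfolding umbilic_def
    by (metis neg_equal_iff_equal)
  have "\<exists>k. \<forall>\<xi> \<eta>. mdot (N \<xi>) (D \<eta>) = k * mdot (D \<xi>) (D \<eta>)"
    by (rule symmetric_form_single_eigenvalue[OF bb b_sym bg mdot_commute g_pos]) (assumption, rule single)
  then obtain k where "N \<xi> = k *\<^sub>R D \<xi>" for \<xi> using tangent0 by blast
  then show thesis using that[of k] unfolding D_def N_def by blast
qed


text \<open>Symmetry of the second derivatives of \<open>\<nu>\<close> and \<open>X\<close> forces
  \<open>\<kappa>' \<eta> *\<^sub>R \<xi> = \<kappa>' \<xi> *\<^sub>R \<eta>\<close>. In dimension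
  at least two this leaves only \<open>\<kappa>' = 0\<close>, and the domain is connected.\<close>

lemma umbilic_parallel_factor_constant:
  assumes "CARD('m) \<ge> 2" and \<nu>: "smooth_on \<nu> U"
    and \<kappa>: "\<And>u \<xi>. u \<in> U \<Longrightarrow>
      frechet_derivative \<nu> (at u) \<xi> = \<kappa> u *\<^sub>R frechet_derivative X (at u) \<xi>"
  obtains k where "\<And>u. u \<in> U \<Longrightarrow> \<kappa> u = k"
proof -
  have "(\<kappa> has_derivative (\<lambda>h. 0)) (at u)" if u: "u \<in> U" for u
  proof -
    define D where "D \<xi> = (\<lambda>y. frechet_derivative X (at y) \<xi>)" for \<xi>
    define N where "N \<xi> = (\<lambda>y. frechet_derivative \<nu> (at y) \<xi>)" for \<xi>
    define H where "H \<xi> = frechet_derivative (D \<xi>) (at u)" for \<xi>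
    define J where "J \<xi> = frechet_derivative (N \<xi>) (at u)" for \<xi>
    have H: "(D \<xi> has_derivative H \<xi>) (at u)" and J: "(N \<xi> has_derivative J \<xi>) (at u)" for \<xi>
      unfolding H_def J_def D_def N_def
      using smooth_on_has_derivative smooth_on_frechet_derivative smooth_surface \<nu> u by blast+
    have symH: "H \<xi> \<eta> = H \<eta> \<xi>" and symJ: "J \<xi> \<eta> = J \<eta> \<xi>" for \<xi> \<eta>
      unfolding H_def J_def D_def N_def
      using smooth_on_second_derivative_symmetric open_domain smooth_surface \<nu> u by blast+
    have linD: "linear (\<lambda>\<xi>. D \<xi> u)" and inj0: "D \<xi> u = 0 \<longleftrightarrow> \<xi> = 0" for \<xi>
      using linear_derivative[OF u] derivative_eq_0_iff[OF u] by (simp_all add: D_def)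
    obtain e :: "real ^ 'm" where "e \<in> Basis" using nonempty_Basis by blast
    then have "e \<noteq> 0" by auto
    \<comment> \<open>The factor \<open>\<kappa>\<close> is given only pointwise. Writing it as a
      quotient of differentiable functions, with any fixed nonzero direction \<open>e\<close>, shows
      that it is differentiable.\<close>
    have quot: "mdot (N e y) (D e y) / mdot (D e y) (D e y) = \<kappa> y" if "y \<in> U" for y
    proof -
      have "mdot (D e y) (D e y) > 0"
        using mdot_tangent_pos[OF that, of "D e y"] derivative_eq_0_iff[OF that, of e] \<open>e \<noteq> 0\<close>
        by (auto simp: D_def tangent_space_def)
      then show ?thesis using \<kappa>[OF that, of e] by (simp add: D_def N_def mdot.scaleR_left)
    qed
    have "mdot (D e u) (D e u) \<noteq> 0"
      using mdot_tangent_pos[OF u, of "D e u"] inj0 \<open>e \<noteq> 0\<close>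
      by (auto simp: D_def tangent_space_def)
    then have "(\<lambda>y. mdot (N e y) (D e y) / mdot (D e y) (D e y)) differentiable (at u)"
      using mdot.FDERIV[OF J H] mdot.FDERIV[OF H H]
      by (intro differentiable_divide) (blast intro: differentiableI)+
    then obtain \<kappa>' where \<kappa>': "(\<kappa> has_derivative \<kappa>') (at u)"
      unfolding differentiable_def
      by (meson has_derivative_transform_within_open[OF _ open_domain u] quot)
    then have lin: "linear \<kappa>'" by (rule has_derivative_linear)
    have Jeq: "J \<xi> \<eta> = \<kappa> u *\<^sub>R H \<xi> \<eta> + \<kappa>' \<eta> *\<^sub>R D \<xi> u" for \<xi> \<eta>
    proof -
      have "((\<lambda>y. \<kappa> y *\<^sub>R D \<xi> y) has_derivative (\<lambda>h. \<kappa> u *\<^sub>R H \<xi> h + \<kappa>' h *\<^sub>R D \<xi> u)) (at u)"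
        by (rule has_derivative_scaleR[OF \<kappa>' H])
      then have "(N \<xi> has_derivative (\<lambda>h. \<kappa> u *\<^sub>R H \<xi> h + \<kappa>' h *\<^sub>R D \<xi> u)) (at u)"
        by (rule has_derivative_transform_within_open[OF _ open_domain u])
          (simp add: \<kappa> N_def D_def)
      then have "J \<xi> = (\<lambda>h. \<kappa> u *\<^sub>R H \<xi> h + \<kappa>' h *\<^sub>R D \<xi> u)"
        using J has_derivative_unique by blast
      then show ?thesis by simp
    qed
    \<comment> \<open>Swapping \<open>\<xi>\<close> and \<open>\<eta>\<close> in \<open>Jeq\<close>
      cancels the Hessians, and injectivity of the differential of \<open>X\<close> removes
      \<open>D\<close>.\<close>
    have cross: "\<kappa>' \<eta> *\<^sub>R \<xi> = \<kappa>' \<xi> *\<^sub>R \<eta>" for \<xi> \<eta>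
    proof -
      have "\<kappa>' \<eta> *\<^sub>R D \<xi> u = \<kappa>' \<xi> *\<^sub>R D \<eta> u"
        using Jeq[of \<xi> \<eta>] Jeq[of \<eta> \<xi>] symH[of \<xi> \<eta>] symJ[of \<xi> \<eta>] by simp
      then have "D (\<kappa>' \<eta> *\<^sub>R \<xi> - \<kappa>' \<xi> *\<^sub>R \<eta>) u = 0"
        using linear_diff[OF linD] linear_cmul[OF linD] by simp
      then show ?thesis using inj0 by simp
    qed
    have "\<kappa>' \<eta> = 0" for \<eta>
    proof (rule ccontr)
      assume "\<kappa>' \<eta> \<noteq> 0"
      \<comment> \<open>A nonzero \<open>\<kappa>' \<eta>\<close> would make every parameter vector
        a multiple of \<open>\<eta>\<close>.\<close>
      have "\<xi> \<in> span {\<eta>}" for \<xi>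
      proof -
        have "\<xi> = (\<kappa>' \<xi> / \<kappa>' \<eta>) *\<^sub>R \<eta>"
          using cross[of \<eta> \<xi>] \<open>\<kappa>' \<eta> \<noteq> 0\<close>
          by (metis divide_inverse_commute scaleR_scaleR scaleR_one left_inverse)
        then show ?thesis by (metis span_base span_scale singletonI)
      qed
      then have "dim (UNIV :: (real ^ 'm) set) \<le> dim {\<eta>}"
        by (metis UNIV_eq_I dim_span order_refl)
      also have "\<dots> \<le> 1" using dim_le_card'[of "{\<eta>}"] by simp
      finally show False using assms(1) by simp
    qed
    then have "\<kappa>' = (\<lambda>h. 0)" by auto
    then show ?thesis using \<kappa>' by simp
  qed
  then have "\<kappa> u = \<kappa> v" if "u \<in> U" "v \<in> U" for u v
    using has_derivative_zero_unique_connected[OF open_domain connected_domain] that by blast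
  then show thesis using that nonempty_domain by (metis ex_in_conv)
qed

text \<open>The difference \<open>\<nu> u - k *\<^sub>R X u\<close> has zero derivative and is
  constant, so \<open>X\<close> is a scaled translate of \<open>\<nu>\<close>, which runs in a round
  sphere at height \<open>r\<close>. Every sphere in a slice of constant height lies in a hyperbolic
  space of radius 1 whose centre is suitably far below.\<close>

lemma umbilic_parallel_imp_right_hypersphere:
  assumes "CARD('m) \<ge> 2" "r > 0" and \<nu>: "smooth_on \<nu> U"
    and N: "\<And>u. u \<in> U \<Longrightarrow> \<nu> u \<in> normal_space X u \<inter> hyperbolic_space (0, -1) 1 \<inter> {x. snd x = r}"
    and par: "parallel_field X U \<nu>" "\<not> \<nu> constant_on U" "umbilic X U \<nu>"
  shows "\<exists>a R c. R > 0 \<and> X ` U \<subseteq> hyperbolic_space a R \<inter> {x. snd x = c}"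
proof -
  have "\<exists>k. \<forall>\<xi>. frechet_derivative \<nu> (at u) \<xi> = k *\<^sub>R frechet_derivative X (at u) \<xi>" if "u \<in> U" for u
    using umbilic_parallel_field_scalar[OF \<nu> _ par(1,3) that] N by (metis IntD1)
  then obtain \<kappa> where \<kappa>: "\<And>u \<xi>. u \<in> U \<Longrightarrow>
      frechet_derivative \<nu> (at u) \<xi> = \<kappa> u *\<^sub>R frechet_derivative X (at u) \<xi>"
    by metis
  obtain k where k: "\<And>u. u \<in> U \<Longrightarrow> \<kappa> u = k"
    using umbilic_parallel_factor_constant[OF assms(1) \<nu> \<kappa>] by blast
  have "((\<lambda>u. \<nu> u - k *\<^sub>R X u) has_derivative (\<lambda>h. 0)) (at u)" if u: "u \<in> U" for u
    using has_derivative_diff[OF smooth_on_has_derivative[OF \<nu> u]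
        has_derivative_scaleR_right[OF has_derivative_surface[OF u], of k]] \<kappa>[OF u] k[OF u] by simp
  then have "\<nu> u - k *\<^sub>R X u = \<nu> v - k *\<^sub>R X v" if "u \<in> U" "v \<in> U" for u v
    using has_derivative_zero_unique_connected[OF open_domain connected_domain] that by blast
  then obtain w where "\<And>u. u \<in> U \<Longrightarrow> \<nu> u - k *\<^sub>R X u = w"
    using nonempty_domain by (metis ex_in_conv)
  then have \<nu>X: "\<nu> u = k *\<^sub>R X u + w" if "u \<in> U" for u
    using that by (metis diff_add_cancel add.commute)
  have "k \<noteq> 0" using \<nu>X par(2) by (force simp: constant_on_def)
  \<comment> \<open>The height \<open>c\<close> solves \<open>r = k * c + snd w\<close>. Points of
    height \<open>r\<close> are \<open>r + 1\<close> above the centre \<open>(0, -1)\<close>, so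
    their spatial square is \<open>(r + 1)\<^sup>2 - 1 = r\<^sup>2 + 2 * r\<close>; division by
    \<open>k\<^sup>2\<close> gives that of \<open>X\<close> about its centre. The drop
    \<open>h\<close> to the new centre is chosen so that the radius is 1.\<close>
  define c where "c = (r - snd w) / k"
  define h where "h = sqrt ((r\<^sup>2 + 2 * r) / k\<^sup>2 + 1)"
  have h: "h \<ge> 0" "h\<^sup>2 = (r\<^sup>2 + 2 * r) / k\<^sup>2 + 1"
    using \<open>r > 0\<close> by (simp_all add: h_def)
  define a where "a = (- (1 / k) *\<^sub>R fst w, c - h)"
  have "X u \<in> hyperbolic_space a 1 \<inter> {x. snd x = c}" if u: "u \<in> U" for u
  proof -
    have "snd (\<nu> u) = r" using N[OF u] by simp
    then have snd: "snd (X u) = c"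
      using \<nu>X[OF u] \<open>k \<noteq> 0\<close> by (simp add: c_def field_simps)
    have fst: "fst (X u) - fst a = (1 / k) *\<^sub>R fst (\<nu> u)"
      using \<nu>X[OF u] \<open>k \<noteq> 0\<close> by (simp add: a_def algebra_simps)
    have "fst (\<nu> u) \<bullet> fst (\<nu> u) - (r + 1) * (r + 1) = - 1"
      using N[OF u] by (auto simp: hyperbolic_space_def mdot_eq_inner)
    then have "fst (\<nu> u) \<bullet> fst (\<nu> u) = r\<^sup>2 + 2 * r"
      by (simp add: algebra_simps power2_eq_square)
    then have "mdot (X u - a) (X u - a) = (r\<^sup>2 + 2 * r) / k\<^sup>2 - h\<^sup>2"
      unfolding mdot_eq_inner using fst snd
      by (simp add: a_def power2_eq_square)
    then show ?thesis using h snd by (simp add: hyperbolic_space_def a_def)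
  qed
  then show ?thesis by (intro exI[of _ a] exI[of _ 1] exI[of _ c]) auto
qed

section \<open>Normal planes and normal fields of a right hypersphere\<close>

text \<open>Tangent vectors have no time component and, since the spatial distance to
  \<open>a\<close> is constant, are orthogonal to \<open>p\<close>. By dimension they fill the
  spatial complement of \<open>p\<close>, so a normal vector has spatial part in the line of
  \<open>p\<close> and an arbitrary time component.\<close>

lemma right_hypersphere_normal_space:
  assumes sph: "X ` U \<subseteq> hyperbolic_space a R \<inter> {x. snd x = c}" and u: "u \<in> U"
  shows "fst (X u) \<noteq> fst a"
    and "normal_space X u = {w. \<exists>s. fst w = s *\<^sub>R (fst (X u) - fst a)}"
proof -
  define D where "D = frechet_derivative X (at u)"
  define p where "p = fst (X u) - fst a"
  have X': "(X has_derivative D) (at u)" using has_derivative_surface[OF u] by (simp add: D_def)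
  have linD: "linear D" using linear_derivative[OF u] by (simp add: D_def)
  have snd: "snd (X y) = c" and norm: "(fst (X y) - fst a) \<bullet> (fst (X y) - fst a) = (c - snd a)\<^sup>2 - R\<^sup>2"
    if "y \<in> U" for y
    using subsetD[OF sph imageI[OF that]]
    by (auto simp: hyperbolic_space_def mdot_eq_inner power2_eq_square)
  have "((\<lambda>y. snd (X y)) has_derivative (\<lambda>h. 0)) (at u)"
    by (rule has_derivative_transform_within_open[OF has_derivative_const[of c] open_domain u])
      (simp add: snd)
  then have sndD: "snd (D \<xi>) = 0" for \<xi>
    using has_derivative_unique has_derivative_snd[OF X'] by metis
  have d: "((\<lambda>y. fst (X y) - fst a) has_derivative (\<lambda>h. fst (D h))) (at u)"
    using has_derivative_diff[OF has_derivative_fst[OF X'] has_derivative_const] by simp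
  have "((\<lambda>y. (fst (X y) - fst a) \<bullet> (fst (X y) - fst a)) has_derivative (\<lambda>h. 0)) (at u)"
    by (rule has_derivative_transform_within_open[OF has_derivative_const open_domain u])
      (simp add: norm)
  then have *: "(\<lambda>h. p \<bullet> fst (D h) + fst (D h) \<bullet> p) = (\<lambda>h. 0)"
    using has_derivative_unique[OF has_derivative_inner[OF d d]] unfolding p_def by blast
  have perp: "fst (D \<xi>) \<bullet> p = 0" for \<xi>
    using fun_cong[OF *, of \<xi>] by (simp add: inner_commute)
  \<comment> \<open>The spatial square is the same constant at all points of \<open>U\<close>; if it
    were 0, then \<open>X\<close> would be constant, against the injectivity of its
    differential.\<close>
  have p0: "p \<noteq> 0"
  proof
    assume "p = 0"
    then have "(fst (X y) - fst a) \<bullet> (fst (X y) - fst a) = 0" if "y \<in> U" for y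
      using norm[OF u] norm[OF that] by (simp add: p_def)
    then have "X y = (fst a, c)" if "y \<in> U" for y
      using snd[OF that] that by (simp add: prod_eq_iff)
    then have "(X has_derivative (\<lambda>h. 0)) (at u)"
      by (intro has_derivative_transform_within_open[OF has_derivative_const open_domain u]) simp
    then have "D = (\<lambda>h. 0)" using X' has_derivative_unique by blast
    moreover obtain e :: "real ^ 'm" where "e \<in> Basis" using nonempty_Basis by blast
    ultimately show False using derivative_eq_0_iff[OF u, of e] by (auto simp: D_def)
  qed
  then show "fst (X u) \<noteq> fst a" by (simp add: p_def)
  \<comment> \<open>The spatial part of the tangent space; it keeps the dimension
    \<open>CARD('m)\<close> because the time components vanish.\<close>
  define F where "F = range (\<lambda>\<xi>. fst (D \<xi>))"
  have linF: "linear (\<lambda>\<xi>. fst (D \<xi>))"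
    using linear_compose[OF linD linear_fst] by (simp add: o_def)
  moreover have "inj (\<lambda>\<xi>. fst (D \<xi>))"
    using inj_derivative[OF u] sndD by (auto simp: inj_def D_def prod_eq_iff)
  ultimately have "dim F = CARD('m)"
    using dim_image_eq[of "\<lambda>\<xi>. fst (D \<xi>)" UNIV] by (simp add: F_def)
  moreover have "subspace F"
    unfolding F_def by (rule linear_subspace_image[OF linF subspace_UNIV])
  then have "dim {y. \<forall>x\<in>F. orthogonal x y} + dim F = CARD('n)"
    using dim_subspace_orthogonal_to_vectors[of F UNIV] by simp
  \<comment> \<open>Codimension two in spacetime is codimension one in space.\<close>
  ultimately have "dim {y. \<forall>x\<in>F. orthogonal x y} = 1" using codim by simp
  moreover have "p \<in> {y. \<forall>x\<in>F. orthogonal x y}"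
    using perp by (auto simp: F_def orthogonal_def)
  moreover have "dim {p} = 1" using p0 by simp
  ultimately have "span {p} = span {y. \<forall>x\<in>F. orthogonal x y}"
    by (intro dim_eq_span) auto
  also have "\<dots> = {y. \<forall>x\<in>F. orthogonal x y}"
    by (rule span_eq_iff[THEN iffD2, OF subspace_orthogonal_to_vectors])
  finally have F: "{y. \<forall>x\<in>F. orthogonal x y} = span {p}" ..
  have "w \<in> normal_space X u \<longleftrightarrow> fst w \<in> {y. \<forall>x\<in>F. orthogonal x y}" for w
    using sndD by (auto simp: normal_space_def tangent_space_def F_def D_def[symmetric]
        orthogonal_def mdot_eq_inner)
  then show "normal_space X u = {w. \<exists>s. fst w = s *\<^sub>R (fst (X u) - fst a)}"
    unfolding F span_singleton by (auto simp: p_def)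
qed

text \<open>The field \<open>(s *\<^sub>R p u, 1)\<close> is a translate of
  \<open>s *\<^sub>R X u\<close>, because \<open>X\<close> has constant height. Its differential is
  therefore \<open>s\<close> times that of \<open>X\<close>: it is tangent and has the single
  principal curvature \<open>- s\<close>.\<close>

lemma right_hypersphere_imp_umbilic_parallel:
  assumes sph: "X ` U \<subseteq> hyperbolic_space a R \<inter> {x. snd x = c}"
  shows "\<exists>np nm. n_fields X U 1 np nm \<and> parallel_field X U np \<and> \<not> np constant_on U \<and> umbilic X U np"
proof -
  define p where "p u = fst (X u) - fst a" for u
  obtain u0 where u0: "u0 \<in> U" using nonempty_domain by blast
  define \<rho> where "\<rho> = norm (p u0)"
  have pp: "p u \<bullet> p u = \<rho>\<^sup>2" if "u \<in> U" for u
    using subsetD[OF sph imageI[OF that]] subsetD[OF sph imageI[OF u0]]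
    by (auto simp: hyperbolic_space_def mdot_eq_inner p_def \<rho>_def power2_norm_eq_inner)
  have "\<rho> > 0" using right_hypersphere_normal_space(1)[OF sph u0] by (simp add: \<rho>_def p_def)
  \<comment> \<open>At height 1 a point is 2 above the centre \<open>(0, -1)\<close>, so its spatial
    square has to be 4 - 1 = 3. The two normal fields are \<open>F s\<close> and
    \<open>F (- s)\<close>.\<close>
  define s where "s = sqrt 3 / \<rho>"
  have s: "s \<noteq> 0" "s\<^sup>2 * \<rho>\<^sup>2 = 3" using \<open>\<rho> > 0\<close> by (simp_all add: s_def power_divide)
  define F where "F t u = (t *\<^sub>R p u, 1::real)" for t u
  have Feq: "F t = (\<lambda>u. (t *\<^sub>R fst (X u), 0) + (- t *\<^sub>R fst a, 1))" for t
    by (auto simp: F_def p_def algebra_simps)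
  have bl: "bounded_linear (\<lambda>w :: 'n mink. (t *\<^sub>R fst w, 0::real))" for t
    by (intro bounded_linear_intros)
  have smooth: "smooth_on (F t) U" for t
    unfolding Feq by (rule smooth_on_affine[OF bl open_domain smooth_surface])
  have "normal_space X u \<inter> hyperbolic_space (0, -1) 1 \<inter> {x. snd x = 1} = {F s u, F (- s) u}"
    if u: "u \<in> U" for u
  proof -
    have "w \<in> normal_space X u \<inter> hyperbolic_space (0, -1) 1 \<inter> {x. snd x = 1} \<longleftrightarrow>
        (\<exists>t. w = F t u \<and> t\<^sup>2 * \<rho>\<^sup>2 = s\<^sup>2 * \<rho>\<^sup>2)" for w
      using right_hypersphere_normal_space(2)[OF sph u] pp[OF u] s(2)
      by (cases w) (auto simp: hyperbolic_space_def mdot_eq_inner F_def p_def power2_eq_square)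
    moreover have "t\<^sup>2 * \<rho>\<^sup>2 = s\<^sup>2 * \<rho>\<^sup>2 \<longleftrightarrow> t = s \<or> t = - s" for t
      using \<open>\<rho> > 0\<close> by (simp add: power2_eq_iff)
    ultimately show ?thesis by auto
  qed
  moreover have "F s u \<noteq> F (- s) u" if "u \<in> U" for u
  proof
    assume "F s u = F (- s) u"
    then have "(s + s) *\<^sub>R p u = 0" unfolding scaleR_add_left by (simp add: F_def)
    then show False using s(1) right_hypersphere_normal_space(1)[OF sph that] by (simp add: p_def)
  qed
  ultimately have fields: "n_fields X U 1 (F s) (F (- s))"
    using smooth by (simp add: n_fields_def)
  have derF: "frechet_derivative (F s) (at u) \<xi> = s *\<^sub>R frechet_derivative X (at u) \<xi>"
    if u: "u \<in> U" for u \<xi>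
  proof -
    have "(F s has_derivative (\<lambda>h. s *\<^sub>R frechet_derivative X (at u) h)) (at u)"
    proof (rule has_derivative_transform_within_open[OF _ open_domain u])
      show "((\<lambda>y. s *\<^sub>R X y + (- s *\<^sub>R fst a, 1 - s * c)) has_derivative
          (\<lambda>h. s *\<^sub>R frechet_derivative X (at u) h)) (at u)"
        using has_derivative_add[OF has_derivative_scaleR_right[OF has_derivative_surface[OF u]]
            has_derivative_const] by simp
      show "s *\<^sub>R X y + (- s *\<^sub>R fst a, 1 - s * c) = F s y" if "y \<in> U" for y
        using sph that by (auto simp: F_def p_def prod_eq_iff algebra_simps)
    qed
    then show ?thesis by (metis frechet_derivative_at)
  qed
  have diff: "field_diff X (F s) u t = s *\<^sub>R t" if "u \<in> U" "t \<in> tangent_space X u" for u t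
    using that field_diff_tangent derF by (auto simp: tangent_space_def)
  then have tan: "field_diff X (F s) u t \<in> tangent_space X u" if "u \<in> U" "t \<in> tangent_space X u" for u t
    using that subspace_scale[OF subspace_tangent_space] by simp
  then have "parallel_field X U (F s)" by (auto simp: parallel_field_def)
  moreover have "umbilic X U (F s)"
  proof -
    have "\<kappa> = - s" if u: "u \<in> U" and pc: "principal_curvature X (F s) u \<kappa>" for u \<kappa>
    proof -
      obtain t where t: "t \<in> tangent_space X u" "t \<noteq> 0" "weingarten X (F s) u t = \<kappa> *\<^sub>R t"
        using pc by (auto simp: principal_curvature_def)
      then have "\<kappa> *\<^sub>R t = - s *\<^sub>R t"
        using tangential_part_tangent[OF u tan[OF u t(1)]] diff[OF u t(1)]
        by (simp add: weingarten_def)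
      then show ?thesis using t(2) by (metis scaleR_cancel_right)
    qed
    then show ?thesis by (auto simp: umbilic_def)
  qed
  moreover have "\<not> F s constant_on U"
  proof
    assume "F s constant_on U"
    then obtain w where "\<And>u. u \<in> U \<Longrightarrow> F s u = w" by (auto simp: constant_on_def)
    then have "(F s has_derivative (\<lambda>h. 0)) (at u0)"
      by (intro has_derivative_transform_within_open[OF has_derivative_const open_domain u0]) simp
    then have "s *\<^sub>R frechet_derivative X (at u0) \<xi> = 0" for \<xi>
      using derF[OF u0, of \<xi>] frechet_derivative_at by metis
    moreover obtain e :: "real ^ 'm" where "e \<in> Basis" using nonempty_Basis by blast
    ultimately show False using derivative_eq_0_iff[OF u0, of e] s(1) by auto
  qed
  ultimately show ?thesis using fields by blast
qed

end

theorem theorem4p8: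
  fixes X :: "real ^ 'm \<Rightarrow> (real ^ 'n) \<times> real" and U :: "(real ^ 'm) set"
  assumes "CARD('n) \<ge> 3"
    and "spacelike_codim2 X U"
  shows "(\<exists>r>0. \<exists>np nm. n_fields X U r np nm \<and>
            (\<exists>\<nu>\<in>{np, nm}. parallel_field X U \<nu> \<and> \<not> \<nu> constant_on U \<and> umbilic X U \<nu>))
     \<longleftrightarrow> (\<exists>a R c. R > 0 \<and> X ` U \<subseteq> hyperbolic_space a R \<inter> {x. snd x = c})"
    (is "?L \<longleftrightarrow> ?R")
proof
  assume ?L
  then obtain r np nm \<nu> where "r > 0" and n: "n_fields X U r np nm" "\<nu> \<in> {np, nm}"
    and \<nu>: "parallel_field X U \<nu>" "\<not> \<nu> constant_on U" "umbilic X U \<nu>"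
    by blast
  \<comment> \<open>The surface has dimension at least two, as the constancy of the factor
    requires.\<close>
  have "CARD('m) \<ge> 2" using assms(1) codim[OF assms(2)] by simp
  moreover have "smooth_on \<nu> U" using n by (auto simp: n_fields_def)
  moreover have "\<nu> u \<in> normal_space X u \<inter> hyperbolic_space (0, -1) 1 \<inter> {x. snd x = r}" if "u \<in> U" for u
    using n that unfolding n_fields_def by blast
  ultimately show ?R
    using umbilic_parallel_imp_right_hypersphere[OF assms(2) _ \<open>r > 0\<close>] \<nu> by blast
next
  assume ?R
  then obtain a R c where "X ` U \<subseteq> hyperbolic_space a R \<inter> {x. snd x = c}" by blast
  from right_hypersphere_imp_umbilic_parallel[OF assms(2) this] show ?L
    by (metis insertI1 zero_less_one)
qed

end
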